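(* Let $k$ be a field, let $X\subseteq k$ be a subset, let $Z\subseteq X\times X$ be such that $xz\in X$ for all $(x,z)\in Z$, and let $\varphi:Z\to X$ be given by $\varphi(x,z)=xz$. Let $A$ be a finite-dimensional associative unital $k$-algebra. (i) For any parameter $q\in k$, the function $R:X\to \mathrm{End}_k(A\otimes A)$ defined by $$R(x)(a\otimes b)=(x-1)\,1\otimes ab+q(x-1)\,ab\otimes 1-(x-q)\,b\otimes a\qquad (a,b\in A)$$ is a one-parameter Yang-Baxter operator (with respect to $\varphi(x,z)=xz$). (ii) Let $q\in k$ and $x\in X$. If $x\neq q$ and $qx\neq 1$, then the operator $R(x)$ defined in (i) is invertible, and for all $a,b\in A$ $$R^{-1}(x)(a\otimes b)=\frac{x-1}{(qx-1)(x-q)}\,ba\otimes 1+\frac{q(x-1)}{(qx-1)(x-q)}\,1\otimes ba-\frac{1}{x-q}\,b\otimes a ,$$ where $R^{-1}(x)$ denotes the inverse of the linear operator $R(x)$. (iii) For any (finite-dimensional) $k$-coalgebra $(C,\Delta,\varepsilon)$ and any parameter $q\in k$, the function $R_C:X\to\mathrm{End}_k(C\otimes C)$ defined by $$R_C(x)(c\otimes d)=(x-1)\,\varepsilon(c)\Delta(d)+q(x-1)\,\varepsilon(d)\Delta(c)-(x-q)\,d\otimes c\qquad (c,d\in C)$$ is a one-parameter Yang-Baxter operator (with respect to $\varphi(x,z)=xz$).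
   Context: All tensor products are over $k$. Let $X$ be a set, $Z\subseteq X\times X$, $\varphi:Z\to X$ a map, and $V$ a finite-dimensional $k$-vector space. A function $R:X\to\mathrm{End}_k(V\otimes V)$ is called a one-parameter Yang-Baxter operator (with respect to $\varphi$) if $$R_{12}(x)R_{13}(\varphi(x,z))R_{23}(z)=R_{23}(z)R_{13}(\varphi(x,z))R_{12}(x)\quad\text{for all }(x,z)\in Z,$$ as operators on $V\otimes V\otimes V$, where for $y\in X$, $R_{12}(y)=R(y)\otimes\mathrm{id}_V$, $R_{23}(y)=\mathrm{id}_V\otimes R(y)$, and $R_{13}(y)$ acts as $R(y)$ on the first and third tensor factors and trivially on the second. Coalgebras are coassociative and counital, with comultiplication $\Delta:C\to C\otimes C$ and counit $\varepsilon:C\to k$. *)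

theory Defs
  imports Complex_Main "HOL-Library.Function_Algebras"
begin

section \<open>Tensor squares and cubes of a vector space\<close>

text \<open>
  A vector space over \<open>'k\<close> is a type \<open>'v\<close> together with a scalar multiplication \<open>s\<close> such that
  \<open>vector_space s\<close>.  The tensor product is realised in the dual of the space of bilinear forms
  (Halmos, Finite-Dimensional Vector Spaces): \<open>a \<otimes> b\<close> is the functional \<open>\<beta> \<mapsto> \<beta> a b\<close>, and
  \<open>V \<otimes> V\<close> is the span of these functionals; likewise \<open>V \<otimes> V \<otimes> V\<close> with trilinear forms.
  Such a functional is represented by a function on all of \<open>'v \<Rightarrow> 'v \<Rightarrow> 'k\<close> that vanishes off the
  bilinear forms.  Over a field this has the universal property of the tensor product, without any
  restriction on the dimension; see \<open>lift2_tens2\<close>, \<open>lift2_unique\<close>, \<open>lift3_tens3\<close>, \<open>lift3_unique\<close>.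
\<close>

definition bilinear_map ::
  "('k::field \<Rightarrow> 'v::ab_group_add \<Rightarrow> 'v) \<Rightarrow> ('k \<Rightarrow> 'u::ab_group_add \<Rightarrow> 'u) \<Rightarrow> ('v \<Rightarrow> 'v \<Rightarrow> 'u) \<Rightarrow> bool"
  where "bilinear_map s s' h \<longleftrightarrow>
    (\<forall>b. Vector_Spaces.linear s s' (\<lambda>a. h a b)) \<and>
    (\<forall>a. Vector_Spaces.linear s s' (\<lambda>b. h a b))"

definition trilinear_map ::
  "('k::field \<Rightarrow> 'v::ab_group_add \<Rightarrow> 'v) \<Rightarrow> ('k \<Rightarrow> 'u::ab_group_add \<Rightarrow> 'u) \<Rightarrow>
   ('v \<Rightarrow> 'v \<Rightarrow> 'v \<Rightarrow> 'u) \<Rightarrow> bool"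
  where "trilinear_map s s' h \<longleftrightarrow>
    (\<forall>b c. Vector_Spaces.linear s s' (\<lambda>a. h a b c)) \<and>
    (\<forall>a c. Vector_Spaces.linear s s' (\<lambda>b. h a b c)) \<and>
    (\<forall>a b. Vector_Spaces.linear s s' (\<lambda>c. h a b c))"

definition fscale :: "'k::field \<Rightarrow> ('f \<Rightarrow> 'k) \<Rightarrow> ('f \<Rightarrow> 'k)"
  where "fscale c f = (\<lambda>x. c * f x)"

type_synonym ('k, 'v) tensor2 = "('v \<Rightarrow> 'v \<Rightarrow> 'k) \<Rightarrow> 'k"
type_synonym ('k, 'v) tensor3 = "('v \<Rightarrow> 'v \<Rightarrow> 'v \<Rightarrow> 'k) \<Rightarrow> 'k"

definition tens2 ::
  "('k::field \<Rightarrow> 'v::ab_group_add \<Rightarrow> 'v) \<Rightarrow> 'v \<Rightarrow> 'v \<Rightarrow> ('k, 'v) tensor2"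
  where "tens2 s a b = (\<lambda>\<beta>. if bilinear_map s (*) \<beta> then \<beta> a b else 0)"

definition tens3 ::
  "('k::field \<Rightarrow> 'v::ab_group_add \<Rightarrow> 'v) \<Rightarrow> 'v \<Rightarrow> 'v \<Rightarrow> 'v \<Rightarrow> ('k, 'v) tensor3"
  where "tens3 s a b c = (\<lambda>\<gamma>. if trilinear_map s (*) \<gamma> then \<gamma> a b c else 0)"

definition T2 :: "('k::field \<Rightarrow> 'v::ab_group_add \<Rightarrow> 'v) \<Rightarrow> ('k, 'v) tensor2 set"
  where "T2 s = module.span fscale {tens2 s a b | a b. True}"

definition T3 :: "('k::field \<Rightarrow> 'v::ab_group_add \<Rightarrow> 'v) \<Rightarrow> ('k, 'v) tensor3 set"
  where "T3 s = module.span fscale {tens3 s a b c | a b c. True}"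

text \<open>
  The linear map \<open>V \<otimes> V \<rightarrow> U\<close> with \<open>a \<otimes> b \<mapsto> h a b\<close> induced by a bilinear map \<open>h\<close>.  Its values
  outside \<open>T2 s\<close> are an arbitrary linear extension and are never used.
\<close>

definition lift2 ::
  "('k::field \<Rightarrow> 'v::ab_group_add \<Rightarrow> 'v) \<Rightarrow> ('k \<Rightarrow> 'u::ab_group_add \<Rightarrow> 'u) \<Rightarrow>
   ('v \<Rightarrow> 'v \<Rightarrow> 'u) \<Rightarrow> ('k, 'v) tensor2 \<Rightarrow> 'u"
  where "lift2 s s' h =
    (SOME f. Vector_Spaces.linear fscale s' f \<and> (\<forall>a b. f (tens2 s a b) = h a b))"

definition lift3 ::
  "('k::field \<Rightarrow> 'v::ab_group_add \<Rightarrow> 'v) \<Rightarrow> ('k \<Rightarrow> 'u::ab_group_add \<Rightarrow> 'u) \<Rightarrow>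
   ('v \<Rightarrow> 'v \<Rightarrow> 'v \<Rightarrow> 'u) \<Rightarrow> ('k, 'v) tensor3 \<Rightarrow> 'u"
  where "lift3 s s' h =
    (SOME f. Vector_Spaces.linear fscale s' f \<and> (\<forall>a b c. f (tens3 s a b c) = h a b c))"

interpretation fscale: vector_space "fscale :: 'k::field \<Rightarrow> ('f \<Rightarrow> 'k) \<Rightarrow> _"
  by standard (auto simp: fscale_def fun_eq_iff algebra_simps)

interpretation times_scale: vector_space "(*) :: 'k::field \<Rightarrow> 'k \<Rightarrow> 'k"
  by standard (auto simp: algebra_simps)

lemma linear_evaluation: "Vector_Spaces.linear fscale (*) (\<lambda>t :: 'f \<Rightarrow> 'k::field. t x)"
  by unfold_locales (auto simp: fscale_def)

text \<open>Separation by functionals reduces the extension problem to targets \<open>'k\<close>.\<close>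

lemma ex_linear_extension:
  fixes s1 :: "'k::field \<Rightarrow> 't::ab_group_add \<Rightarrow> 't" and s2 :: "'k \<Rightarrow> 'u::ab_group_add \<Rightarrow> 'u"
    and g :: "'i \<Rightarrow> 't" and h :: "'i \<Rightarrow> 'u"
  assumes "vector_space s1" "vector_space s2"
    and sep: "\<And>\<phi>. Vector_Spaces.linear s2 (*) \<phi> \<Longrightarrow>
      \<exists>\<psi>. Vector_Spaces.linear s1 (*) \<psi> \<and> (\<forall>i. \<psi> (g i) = \<phi> (h i))"
  shows "\<exists>f. Vector_Spaces.linear s1 s2 f \<and> (\<forall>i. f (g i) = h i)"
proof -
  interpret p: vector_space_pair s1 s2
    using assms(1,2) by (simp add: vector_space_pair_def)
  interpret u: vector_space_pair s2 "(*) :: 'k \<Rightarrow> 'k \<Rightarrow> 'k"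
    using assms(2) times_scale.vector_space_axioms by (simp add: vector_space_pair_def)
  obtain B where B: "B \<subseteq> range g" "p.vs1.independent B" "range g \<subseteq> p.vs1.span B"
    using p.vs1.maximal_independent_subset[of "range g"] by metis
  from B(1) have "\<forall>b\<in>B. \<exists>i. b = g i" by auto
  then obtain j where j: "\<And>b. b \<in> B \<Longrightarrow> b = g (j b)" by metis
  define f where "f = p.construct B (\<lambda>b. h (j b))"
  have f: "Vector_Spaces.linear s1 s2 f"
    unfolding f_def by (rule p.linear_construct[OF B(2)])
  interpret f: Vector_Spaces.linear s1 s2 f by (rule f)
  have fB: "f b = h (j b)" if "b \<in> B" for b
    unfolding f_def by (rule p.construct_basis[OF B(2) that])
  have "f (g i) = h i" for i
  proof (rule ccontr)
    assume neq: "f (g i) \<noteq> h i"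
    define d where "d = f (g i) - h i"
    have "d \<noteq> 0" using neq by (simp add: d_def)
    then have ind: "p.vs2.independent {d}" by simp
    define \<phi> where "\<phi> = u.construct {d} (\<lambda>_. 1 :: 'k)"
    have \<phi>: "Vector_Spaces.linear s2 (*) \<phi>"
      unfolding \<phi>_def by (rule u.linear_construct[OF ind])
    interpret \<phi>: Vector_Spaces.linear s2 "(*)" \<phi> by (rule \<phi>)
    have "\<phi> d = 1" unfolding \<phi>_def by (rule u.construct_basis[OF ind]) simp
    obtain \<psi> where \<psi>: "Vector_Spaces.linear s1 (*) \<psi>" "\<And>i. \<psi> (g i) = \<phi> (h i)"
      using sep[OF \<phi>] by blast
    interpret \<psi>: Vector_Spaces.linear s1 "(*)" \<psi> by (rule \<psi>(1))
    have "g i \<in> p.vs1.span B" using B(3) by auto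
    then have "\<phi> (f (g i)) = \<psi> (g i)"
    proof (induction rule: p.vs1.span_induct_alt)
      case base
      show ?case by simp
    next
      case (step c x y)
      then show ?case
        using fB[of x] j[of x] \<psi>(2)[of "j x"]
        by (simp add: f.add f.scale \<phi>.add \<phi>.scale \<psi>.add \<psi>.scale)
    qed
    then have "\<phi> d = 0" by (simp add: d_def \<phi>.diff \<psi>(2))
    with \<open>\<phi> d = 1\<close> show False by simp
  qed
  with f show ?thesis by blast
qed

lemma lift2_tens2:
  fixes s :: "'k::field \<Rightarrow> 'v::ab_group_add \<Rightarrow> 'v" and s' :: "'k \<Rightarrow> 'u::ab_group_add \<Rightarrow> 'u"
  assumes h: "bilinear_map s s' h"
  shows "Vector_Spaces.linear fscale s' (lift2 s s' h)"
    and "lift2 s s' h (tens2 s a b) = h a b"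
proof -
  have "vector_space s'"
    using h by (auto simp: bilinear_map_def Vector_Spaces.linear_def)
  have "\<exists>f. Vector_Spaces.linear fscale s' f \<and> (\<forall>i. f (case i of (a, b) \<Rightarrow> tens2 s a b) =
      (case i of (a, b) \<Rightarrow> h a b))"
  proof (rule ex_linear_extension[OF fscale.vector_space_axioms \<open>vector_space s'\<close>])
    fix \<phi> :: "'u \<Rightarrow> 'k" assume \<phi>: "Vector_Spaces.linear s' (*) \<phi>"
    let ?\<beta> = "\<lambda>a b. \<phi> (h a b)"
    have "bilinear_map s (*) ?\<beta>"
      using h \<phi> Vector_Spaces.linear_compose[of s s' _ "(*)" \<phi>] unfolding bilinear_map_def o_def by blast
    then have "\<forall>i. (case i of (a, b) \<Rightarrow> tens2 s a b) ?\<beta> = \<phi> (case i of (a, b) \<Rightarrow> h a b)"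
      by (auto simp: tens2_def)
    then show "\<exists>\<psi>. Vector_Spaces.linear fscale (*) \<psi> \<and>
        (\<forall>i. \<psi> (case i of (a, b) \<Rightarrow> tens2 s a b) = \<phi> (case i of (a, b) \<Rightarrow> h a b))"
      by (intro exI[of _ "\<lambda>t. t ?\<beta>"] conjI linear_evaluation)
  qed
  then have "\<exists>f. Vector_Spaces.linear fscale s' f \<and> (\<forall>a b. f (tens2 s a b) = h a b)"
    by (simp add: split_paired_all)
  from someI_ex[OF this]
  show "Vector_Spaces.linear fscale s' (lift2 s s' h)" "lift2 s s' h (tens2 s a b) = h a b"
    by (simp_all add: lift2_def)
qed

lemma lift3_tens3:
  fixes s :: "'k::field \<Rightarrow> 'v::ab_group_add \<Rightarrow> 'v" and s' :: "'k \<Rightarrow> 'u::ab_group_add \<Rightarrow> 'u"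
  assumes h: "trilinear_map s s' h"
  shows "Vector_Spaces.linear fscale s' (lift3 s s' h)"
    and "lift3 s s' h (tens3 s a b c) = h a b c"
proof -
  have "vector_space s'"
    using h by (auto simp: trilinear_map_def Vector_Spaces.linear_def)
  have "\<exists>f. Vector_Spaces.linear fscale s' f \<and> (\<forall>i. f (case i of (a, b, c) \<Rightarrow> tens3 s a b c) =
      (case i of (a, b, c) \<Rightarrow> h a b c))"
  proof (rule ex_linear_extension[OF fscale.vector_space_axioms \<open>vector_space s'\<close>])
    fix \<phi> :: "'u \<Rightarrow> 'k" assume \<phi>: "Vector_Spaces.linear s' (*) \<phi>"
    let ?\<gamma> = "\<lambda>a b c. \<phi> (h a b c)"
    have "trilinear_map s (*) ?\<gamma>"
      using h \<phi> Vector_Spaces.linear_compose[of s s' _ "(*)" \<phi>] unfolding trilinear_map_def o_def by blast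
    then have "\<forall>i. (case i of (a, b, c) \<Rightarrow> tens3 s a b c) ?\<gamma> = \<phi> (case i of (a, b, c) \<Rightarrow> h a b c)"
      by (auto simp: tens3_def)
    then show "\<exists>\<psi>. Vector_Spaces.linear fscale (*) \<psi> \<and>
        (\<forall>i. \<psi> (case i of (a, b, c) \<Rightarrow> tens3 s a b c) = \<phi> (case i of (a, b, c) \<Rightarrow> h a b c))"
      by (intro exI[of _ "\<lambda>t. t ?\<gamma>"] conjI linear_evaluation)
  qed
  then have "\<exists>f. Vector_Spaces.linear fscale s' f \<and> (\<forall>a b c. f (tens3 s a b c) = h a b c)"
    by (simp add: split_paired_all)
  from someI_ex[OF this]
  show "Vector_Spaces.linear fscale s' (lift3 s s' h)" "lift3 s s' h (tens3 s a b c) = h a b c"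
    by (simp_all add: lift3_def)
qed

text \<open>A linear map out of \<open>V \<otimes> V\<close> or \<open>V \<otimes> V \<otimes> V\<close>, as a map that is only relevant on that span.\<close>

definition linear_within ::
  "('k::field \<Rightarrow> 't::ab_group_add \<Rightarrow> 't) \<Rightarrow> ('k \<Rightarrow> 'u::ab_group_add \<Rightarrow> 'u) \<Rightarrow> 't set \<Rightarrow> ('t \<Rightarrow> 'u) \<Rightarrow> bool"
  where "linear_within s s' S F \<longleftrightarrow>
    (\<forall>t\<in>S. \<forall>u\<in>S. F (t + u) = F t + F u) \<and> (\<forall>c. \<forall>t\<in>S. F (s c t) = s' c (F t))"

lemma linear_within_unique:
  assumes "vector_space s" "vector_space s'"
    and F: "linear_within s s' (module.span s G) F"
    and F': "linear_within s s' (module.span s G) F'"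
    and eq: "\<And>g. g \<in> G \<Longrightarrow> F g = F' g"
    and t: "t \<in> module.span s G"
  shows "F t = F' t"
proof -
  interpret v: vector_space s by fact
  interpret u: vector_space s' by fact
  from t have "t \<in> v.span G \<and> F t = F' t"
  proof (induction rule: v.span_induct_alt)
    case base
    have zero: "f 0 = 0" if "linear_within s s' (v.span G) f" for f
    proof -
      have "f (s 0 0) = s' 0 (f 0)" using that v.span_zero unfolding linear_within_def by blast
      then show ?thesis by simp
    qed
    show ?case by (simp add: zero[OF F] zero[OF F'] v.span_zero)
  next
    case (step c x y)
    then have "x \<in> v.span G" "s c x \<in> v.span G" by (auto intro: v.span_base v.span_scale)
    with step F F' eq[of x] show ?case
      unfolding linear_within_def by (simp add: v.span_add)
  qed
  then show ?thesis by simp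
qed

lemma lift2_unique:
  assumes "bilinear_map s s' h" "linear_within fscale s' (T2 s) F"
    and "\<And>a b. F (tens2 s a b) = h a b" and t: "t \<in> T2 s"
  shows "F t = lift2 s s' h t"
proof -
  interpret l: Vector_Spaces.linear fscale s' "lift2 s s' h"
    by (rule lift2_tens2(1)[OF assms(1)])
  show ?thesis
    by (rule linear_within_unique[OF fscale.vector_space_axioms l.vs2.vector_space_axioms
          assms(2)[unfolded T2_def] _ _ t[unfolded T2_def]])
      (auto simp: linear_within_def l.add l.scale assms(3) lift2_tens2(2)[OF assms(1)])
qed

lemma lift3_unique:
  assumes "trilinear_map s s' h" "linear_within fscale s' (T3 s) F"
    and "\<And>a b c. F (tens3 s a b c) = h a b c" and t: "t \<in> T3 s"
  shows "F t = lift3 s s' h t"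
proof -
  interpret l: Vector_Spaces.linear fscale s' "lift3 s s' h"
    by (rule lift3_tens3(1)[OF assms(1)])
  show ?thesis
    by (rule linear_within_unique[OF fscale.vector_space_axioms l.vs2.vector_space_axioms
          assms(2)[unfolded T3_def] _ _ t[unfolded T3_def]])
      (auto simp: linear_within_def l.add l.scale assms(3) lift3_tens3(2)[OF assms(1)])
qed

lemma bilinear_tens2:
  assumes "vector_space s"
  shows "bilinear_map s fscale (tens2 s)"
proof -
  interpret vector_space s by fact
  have *: "\<beta> (x + y) b = \<beta> x b + \<beta> y b" "\<beta> b (x + y) = \<beta> b x + \<beta> b y"
    "\<beta> (s c x) b = c * \<beta> x b" "\<beta> b (s c x) = c * \<beta> b x"
    if "bilinear_map s (*) \<beta>" for \<beta> x y b c
    using that unfolding bilinear_map_def Vector_Spaces.linear_def module_hom_def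
      module_hom_axioms_def by blast+
  show ?thesis
    unfolding bilinear_map_def
    by (intro allI conjI; unfold_locales) (auto simp: tens2_def fscale_def fun_eq_iff *)
qed

lemma trilinear_tens3:
  assumes "vector_space s"
  shows "trilinear_map s fscale (tens3 s)"
proof -
  interpret vector_space s by fact
  have *: "\<gamma> (x + y) b d = \<gamma> x b d + \<gamma> y b d" "\<gamma> b (x + y) d = \<gamma> b x d + \<gamma> b y d"
    "\<gamma> b d (x + y) = \<gamma> b d x + \<gamma> b d y"
    "\<gamma> (s c x) b d = c * \<gamma> x b d" "\<gamma> b (s c x) d = c * \<gamma> b x d" "\<gamma> b d (s c x) = c * \<gamma> b d x"
    if "trilinear_map s (*) \<gamma>" for \<gamma> x y b c d
    using that unfolding trilinear_map_def Vector_Spaces.linear_def module_hom_def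
      module_hom_axioms_def by blast+
  show ?thesis
    unfolding trilinear_map_def
    by (intro allI conjI; unfold_locales) (auto simp: tens3_def fscale_def fun_eq_iff *)
qed

section \<open>Operators and the Yang-Baxter equation\<close>

text \<open>The underlying function of an element of \<open>End (V \<otimes> V)\<close> only matters on \<open>V \<otimes> V\<close>.\<close>

definition End2 ::
  "('k::field \<Rightarrow> 'v::ab_group_add \<Rightarrow> 'v) \<Rightarrow> (('k, 'v) tensor2 \<Rightarrow> ('k, 'v) tensor2) set"
  where "End2 s = {F. F ` T2 s \<subseteq> T2 s \<and> linear_within fscale fscale (T2 s) F}"

text \<open>
  \<open>place12 s c\<close> is \<open>t \<mapsto> t \<otimes> c\<close>, \<open>place23 s c\<close> is \<open>t \<mapsto> c \<otimes> t\<close>, and \<open>place13 s c\<close> inserts \<open>c\<close>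
  between the two factors of \<open>t\<close>; all of them map \<open>V \<otimes> V\<close> to \<open>V \<otimes> V \<otimes> V\<close>.
\<close>

definition place12 ::
  "('k::field \<Rightarrow> 'v::ab_group_add \<Rightarrow> 'v) \<Rightarrow> 'v \<Rightarrow> ('k, 'v) tensor2 \<Rightarrow> ('k, 'v) tensor3"
  where "place12 s c = lift2 s fscale (\<lambda>a b. tens3 s a b c)"

definition place13 ::
  "('k::field \<Rightarrow> 'v::ab_group_add \<Rightarrow> 'v) \<Rightarrow> 'v \<Rightarrow> ('k, 'v) tensor2 \<Rightarrow> ('k, 'v) tensor3"
  where "place13 s c = lift2 s fscale (\<lambda>a b. tens3 s a c b)"

definition place23 ::
  "('k::field \<Rightarrow> 'v::ab_group_add \<Rightarrow> 'v) \<Rightarrow> 'v \<Rightarrow> ('k, 'v) tensor2 \<Rightarrow> ('k, 'v) tensor3"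
  where "place23 s c = lift2 s fscale (\<lambda>a b. tens3 s c a b)"

text \<open>For \<open>F \<in> End (V \<otimes> V)\<close>: \<open>F \<otimes> id\<close>, the action of \<open>F\<close> on the outer factors, and \<open>id \<otimes> F\<close>.\<close>

definition leg12 ::
  "('k::field \<Rightarrow> 'v::ab_group_add \<Rightarrow> 'v) \<Rightarrow> (('k, 'v) tensor2 \<Rightarrow> ('k, 'v) tensor2) \<Rightarrow>
   ('k, 'v) tensor3 \<Rightarrow> ('k, 'v) tensor3"
  where "leg12 s F = lift3 s fscale (\<lambda>a b c. place12 s c (F (tens2 s a b)))"

definition leg13 ::
  "('k::field \<Rightarrow> 'v::ab_group_add \<Rightarrow> 'v) \<Rightarrow> (('k, 'v) tensor2 \<Rightarrow> ('k, 'v) tensor2) \<Rightarrow>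
   ('k, 'v) tensor3 \<Rightarrow> ('k, 'v) tensor3"
  where "leg13 s F = lift3 s fscale (\<lambda>a b c. place13 s b (F (tens2 s a c)))"

definition leg23 ::
  "('k::field \<Rightarrow> 'v::ab_group_add \<Rightarrow> 'v) \<Rightarrow> (('k, 'v) tensor2 \<Rightarrow> ('k, 'v) tensor2) \<Rightarrow>
   ('k, 'v) tensor3 \<Rightarrow> ('k, 'v) tensor3"
  where "leg23 s F = lift3 s fscale (\<lambda>a b c. place23 s a (F (tens2 s b c)))"

definition fin_dim :: "('k::field \<Rightarrow> 'v::ab_group_add \<Rightarrow> 'v) \<Rightarrow> bool"
  where "fin_dim s \<longleftrightarrow> (\<exists>B. finite_dimensional_vector_space s B)"

definition yang_baxter_operator ::
  "('k::field \<Rightarrow> 'v::ab_group_add \<Rightarrow> 'v) \<Rightarrow> 'x set \<Rightarrow> ('x \<times> 'x) set \<Rightarrow> ('x \<times> 'x \<Rightarrow> 'x) \<Rightarrow>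
   ('x \<Rightarrow> ('k, 'v) tensor2 \<Rightarrow> ('k, 'v) tensor2) \<Rightarrow> bool"
  where "yang_baxter_operator s X Z \<phi> R \<longleftrightarrow>
    fin_dim s \<and> Z \<subseteq> X \<times> X \<and> (\<forall>p\<in>Z. \<phi> p \<in> X) \<and> (\<forall>x\<in>X. R x \<in> End2 s) \<and>
    (\<forall>(x, z)\<in>Z. \<forall>t\<in>T3 s.
      leg12 s (R x) (leg13 s (R (\<phi> (x, z))) (leg23 s (R z) t)) =
      leg23 s (R z) (leg13 s (R (\<phi> (x, z))) (leg12 s (R x) t)))"

section \<open>Algebras and coalgebras\<close>

text \<open>
  Associativity, distributivity and the unit laws come from the sort of \<open>'a\<close>, which, unlike
  \<open>ring_1\<close>, admits the zero algebra.
\<close>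

locale fd_algebra =
  fixes s :: "'k::field \<Rightarrow> 'a::{ring, monoid_mult} \<Rightarrow> 'a"
  assumes fin_dim: "fin_dim s"
    and scale_mult_left: "s c a * b = s c (a * b)"
    and scale_mult_right: "a * s c b = s c (a * b)"

text \<open>
  The four maps built with \<open>lift2\<close> are \<open>\<Delta> \<otimes> id\<close>, \<open>id \<otimes> \<Delta>\<close>, \<open>\<epsilon> \<otimes> id\<close> and \<open>id \<otimes> \<epsilon>\<close>, the last two
  after the identifications of \<open>k \<otimes> C\<close> and \<open>C \<otimes> k\<close> with \<open>C\<close>.
\<close>

locale fd_coalgebra =
  fixes s :: "'k::field \<Rightarrow> 'c::ab_group_add \<Rightarrow> 'c"
    and \<Delta> :: "'c \<Rightarrow> ('k, 'c) tensor2"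
    and \<epsilon> :: "'c \<Rightarrow> 'k"
  assumes fin_dim: "fin_dim s"
    and comult_linear: "Vector_Spaces.linear s fscale \<Delta>"
    and comult_in: "\<Delta> c \<in> T2 s"
    and counit_linear: "Vector_Spaces.linear s (*) \<epsilon>"
    and coassoc: "lift2 s fscale (\<lambda>a b. place12 s b (\<Delta> a)) (\<Delta> c) =
      lift2 s fscale (\<lambda>a b. place23 s a (\<Delta> b)) (\<Delta> c)"
    and counit_left: "lift2 s s (\<lambda>a b. s (\<epsilon> a) b) (\<Delta> c) = c"
    and counit_right: "lift2 s s (\<lambda>a b. s (\<epsilon> b) a) (\<Delta> c) = c"

definition algebra_YB ::
  "('k::field \<Rightarrow> 'a::{ring, monoid_mult} \<Rightarrow> 'a) \<Rightarrow> 'k \<Rightarrow> 'k \<Rightarrow> ('k, 'a) tensor2 \<Rightarrow> ('k, 'a) tensor2"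
  where "algebra_YB s q x = lift2 s fscale (\<lambda>a b.
    fscale (x - 1) (tens2 s 1 (a * b)) + fscale (q * (x - 1)) (tens2 s (a * b) 1)
    - fscale (x - q) (tens2 s b a))"

definition coalgebra_YB ::
  "('k::field \<Rightarrow> 'c::ab_group_add \<Rightarrow> 'c) \<Rightarrow> ('c \<Rightarrow> ('k, 'c) tensor2) \<Rightarrow> ('c \<Rightarrow> 'k) \<Rightarrow> 'k \<Rightarrow> 'k \<Rightarrow>
   ('k, 'c) tensor2 \<Rightarrow> ('k, 'c) tensor2"
  where "coalgebra_YB s \<Delta> \<epsilon> q x = lift2 s fscale (\<lambda>c d.
    fscale ((x - 1) * \<epsilon> c) (\<Delta> d) + fscale (q * (x - 1) * \<epsilon> d) (\<Delta> c)
    - fscale (x - q) (tens2 s d c))"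

end

theory Submission
  imports Defs
begin

text \<open>
  An element of \<open>V \<otimes> V \<otimes> V\<close> is a functional on trilinear forms, so an operator may be replaced by its
  transpose on trilinear forms, and the Yang-Baxter equation becomes a pointwise identity between
  forms.  For an algebra both sides are then explicit combinations of values of the form, and comparing
  coefficients suffices.  For a coalgebra \<open>\<Delta> c\<close> acts on bilinear forms as a Sweedler sum;
  coassociativity and the counit laws bring all terms into a normal form, after which a polynomial
  identity in \<open>x\<close>, \<open>z\<close>, \<open>q\<close> remains.
\<close>

text \<open>This rule loops with associativity of multiplication in \<open>algebra_simps\<close>.\<close>

declare times_scale.scale_scale [simp del]

section \<open>Multilinear maps into spaces of functions\<close>

lemma linear_form_iff:
  assumes "vector_space s"
  shows "Vector_Spaces.linear s (*) f \<longleftrightarrow>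
    (\<forall>x y. f (x + y) = f x + f y) \<and> (\<forall>c x. f (s c x) = c * f x)"
proof -
  interpret vector_space s by fact
  show ?thesis
    by (auto simp: Vector_Spaces.linear_def module_hom_def module_hom_axioms_def
        vector_space_axioms times_scale.vector_space_axioms module_axioms times_scale.module_axioms)
qed

text \<open>Addition and \<open>fscale\<close> act pointwise on functions, so linearity can be
  tested after evaluation at each argument. The bilinear and trilinear versions below reduce
  tensor-valued claims to scalar-valued ones in the same way.\<close>

lemma linear_fscaleI:
  assumes "vector_space s" "\<And>\<beta>. Vector_Spaces.linear s (*) (\<lambda>a. f a \<beta>)"
  shows "Vector_Spaces.linear s fscale f"
proof -
  interpret vector_space s by fact
  show ?thesis
    using assms(2) by unfold_locales (auto simp: linear_form_iff[OF assms(1)] fun_eq_iff fscale_def)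
qed

lemma linear_fscaleD:
  assumes "Vector_Spaces.linear s fscale f"
  shows "Vector_Spaces.linear s (*) (\<lambda>a. f a \<beta>)"
  using Vector_Spaces.linear_compose[OF assms linear_evaluation[of \<beta>]] by (simp add: o_def)

lemma bilinear_fscaleI:
  assumes "vector_space s" "\<And>\<beta>. bilinear_map s (*) (\<lambda>a b. h a b \<beta>)"
  shows "bilinear_map s fscale h"
  using assms by (auto simp: bilinear_map_def intro!: linear_fscaleI)

lemma bilinear_fscaleD:
  assumes "bilinear_map s fscale h"
  shows "bilinear_map s (*) (\<lambda>a b. h a b \<beta>)"
  using assms by (auto simp: bilinear_map_def intro: linear_fscaleD)

lemma trilinear_fscaleI:
  assumes "vector_space s" "\<And>\<gamma>. trilinear_map s (*) (\<lambda>a b c. h a b c \<gamma>)"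
  shows "trilinear_map s fscale h"
  using assms by (auto simp: trilinear_map_def intro!: linear_fscaleI)

lemma trilinear_fscaleD:
  assumes "trilinear_map s fscale h"
  shows "trilinear_map s (*) (\<lambda>a b c. h a b c \<gamma>)"
  using assms by (auto simp: trilinear_map_def intro: linear_fscaleD)

lemma bilinear_form_iff:
  assumes "vector_space s"
  shows "bilinear_map s (*) \<beta> \<longleftrightarrow>
    (\<forall>x y b. \<beta> (x + y) b = \<beta> x b + \<beta> y b) \<and> (\<forall>c x b. \<beta> (s c x) b = c * \<beta> x b) \<and>
    (\<forall>x y a. \<beta> a (x + y) = \<beta> a x + \<beta> a y) \<and> (\<forall>c x a. \<beta> a (s c x) = c * \<beta> a x)"
  unfolding bilinear_map_def linear_form_iff[OF assms] by blast

lemma trilinear_slices: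
  assumes "trilinear_map s s' \<gamma>"
  shows "bilinear_map s s' (\<lambda>u v. \<gamma> u v c)" "bilinear_map s s' (\<lambda>u v. \<gamma> u c v)"
    "bilinear_map s s' (\<lambda>u v. \<gamma> c u v)"
  using assms by (auto simp: trilinear_map_def bilinear_map_def)

section \<open>Tensors as functionals on multilinear forms\<close>

lemma tens2_in_T2: "tens2 s a b \<in> T2 s"
  unfolding T2_def by (rule fscale.span_base) blast

lemma tens3_in_T3: "tens3 s a b c \<in> T3 s"
  unfolding T3_def by (rule fscale.span_base) blast

lemmas T2_closed =
  fscale.span_add[of _ "{tens2 s a b | a b. True}" for s, folded T2_def]
  fscale.span_diff[of _ "{tens2 s a b | a b. True}" for s, folded T2_def]
  fscale.span_scale[of _ "{tens2 s a b | a b. True}" for s, folded T2_def]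
  tens2_in_T2

lemma T2_subspace: "fscale.subspace (T2 s)"
  unfolding T2_def by simp

lemma T3_subspace: "fscale.subspace (T3 s)"
  unfolding T3_def by simp

text \<open>A scalar coefficient is absorbed into the first factor, so a plain list of pairs records
  a tensor. One list serves every bilinear \<open>\<beta>\<close>; this uniformity later allows
  \<open>t\<close> to be treated as a fixed finite sum.\<close>

lemma T2_Sweedler:
  assumes "vector_space s" "t \<in> T2 s"
  shows "\<exists>xs. \<forall>\<beta>. bilinear_map s (*) \<beta> \<longrightarrow> t \<beta> = (\<Sum>(a, b)\<leftarrow>xs. \<beta> a b)"
  using assms(2) unfolding T2_def
proof (induction rule: fscale.span_induct_alt)
  case base
  show ?case by (intro exI[of _ "[]"]) simp
next
  case (step c x y)
  then obtain a b xs where "x = tens2 s a b"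
    and xs: "\<And>\<beta>. bilinear_map s (*) \<beta> \<Longrightarrow> y \<beta> = (\<Sum>(a, b)\<leftarrow>xs. \<beta> a b)" by blast
  then show ?case
    by (intro exI[of _ "(s c a, b) # xs"])
      (auto simp: fscale_def tens2_def bilinear_form_iff[OF assms(1)])
qed

text \<open>\<open>tens3\<close> takes the default value 0 off the trilinear forms, and this
  vanishing passes to the span; hence trilinear forms already separate the elements of
  \<open>T3 s\<close>.\<close>

lemma T3_eqI:
  assumes "t \<in> T3 s" "u \<in> T3 s" "\<And>\<gamma>. trilinear_map s (*) \<gamma> \<Longrightarrow> t \<gamma> = u \<gamma>"
  shows "t = u"
proof -
  have "t \<gamma> = 0" if "t \<in> T3 s" "\<not> trilinear_map s (*) \<gamma>" for t \<gamma>
    using that(1) unfolding T3_def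
    by (induction rule: fscale.span_induct_alt) (use that(2) in \<open>auto simp: fscale_def tens3_def\<close>)
  with assms show ?thesis by (metis ext)
qed

text \<open>Both sides are linear in \<open>t\<close> and agree on pure tensors. The choice hidden
  in \<open>lift2\<close> disappears: a functional of an induced map is computed by evaluating
  \<open>t\<close> at the composed form.\<close>

lemma form_lift2:
  assumes h: "bilinear_map s s' h" and \<phi>: "Vector_Spaces.linear s' (*) \<phi>" and t: "t \<in> T2 s"
  shows "\<phi> (lift2 s s' h t) = t (\<lambda>a b. \<phi> (h a b))"
proof -
  interpret l: Vector_Spaces.linear fscale s' "lift2 s s' h" by (rule lift2_tens2[OF h])
  interpret \<phi>: Vector_Spaces.linear s' "(*)" \<phi> by fact
  have \<beta>: "bilinear_map s (*) (\<lambda>a b. \<phi> (h a b))"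
    using h \<phi> Vector_Spaces.linear_compose[of s s' _ "(*)" \<phi>]
    unfolding bilinear_map_def o_def by blast
  from t show ?thesis unfolding T2_def
  proof (induction rule: fscale.span_induct_alt)
    case base
    show ?case unfolding l.zero \<phi>.zero by simp
  next
    case (step c x y)
    then obtain a b where x: "x = tens2 s a b" by blast
    show ?case
      using \<beta> unfolding x l.add l.scale \<phi>.add \<phi>.scale lift2_tens2(2)[OF h] step.IH
      by (simp add: tens2_def fscale_def)
  qed
qed

lemma form_lift3:
  assumes h: "trilinear_map s s' h" and \<phi>: "Vector_Spaces.linear s' (*) \<phi>" and t: "t \<in> T3 s"
  shows "\<phi> (lift3 s s' h t) = t (\<lambda>a b c. \<phi> (h a b c))"
proof -
  interpret l: Vector_Spaces.linear fscale s' "lift3 s s' h" by (rule lift3_tens3[OF h])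
  interpret \<phi>: Vector_Spaces.linear s' "(*)" \<phi> by fact
  have \<beta>: "trilinear_map s (*) (\<lambda>a b c. \<phi> (h a b c))"
    using h \<phi> Vector_Spaces.linear_compose[of s s' _ "(*)" \<phi>]
    unfolding trilinear_map_def o_def by blast
  from t show ?thesis unfolding T3_def
  proof (induction rule: fscale.span_induct_alt)
    case base
    show ?case unfolding l.zero \<phi>.zero by simp
  next
    case (step c x y)
    then obtain a b d where x: "x = tens3 s a b d" by blast
    show ?case
      using \<beta> unfolding x l.add l.scale \<phi>.add \<phi>.scale lift3_tens3(2)[OF h] step.IH
      by (simp add: tens3_def fscale_def)
  qed
qed

lemma lift2_in_subspace:
  assumes h: "bilinear_map s fscale h" and S: "fscale.subspace S" "\<And>a b. h a b \<in> S"
    and t: "t \<in> T2 s"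
  shows "lift2 s fscale h t \<in> S"
proof -
  interpret l: Vector_Spaces.linear fscale fscale "lift2 s fscale h" by (rule lift2_tens2[OF h])
  from t show ?thesis unfolding T2_def
  proof (induction rule: fscale.span_induct_alt)
    case base
    show ?case by (simp only: l.zero fscale.subspace_0[OF S(1)])
  next
    case (step c x y)
    then obtain a b where "x = tens2 s a b" by blast
    with step.IH show ?case
      by (simp only: l.add l.scale lift2_tens2(2)[OF h] S(2)
          fscale.subspace_add[OF S(1)] fscale.subspace_scale[OF S(1)])
  qed
qed

lemma lift3_in_subspace:
  assumes h: "trilinear_map s fscale h" and S: "fscale.subspace S" "\<And>a b c. h a b c \<in> S"
    and t: "t \<in> T3 s"
  shows "lift3 s fscale h t \<in> S"
proof -
  interpret l: Vector_Spaces.linear fscale fscale "lift3 s fscale h" by (rule lift3_tens3[OF h])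
  from t show ?thesis unfolding T3_def
  proof (induction rule: fscale.span_induct_alt)
    case base
    show ?case by (simp only: l.zero fscale.subspace_0[OF S(1)])
  next
    case (step c x y)
    then obtain a b d where "x = tens3 s a b d" by blast
    with step.IH show ?case
      by (simp only: l.add l.scale lift3_tens3(2)[OF h] S(2)
          fscale.subspace_add[OF S(1)] fscale.subspace_scale[OF S(1)])
  qed
qed

lemma lift2_in_End2:
  assumes "bilinear_map s fscale h" "\<And>a b. h a b \<in> T2 s"
  shows "lift2 s fscale h \<in> End2 s"
proof -
  interpret l: Vector_Spaces.linear fscale fscale "lift2 s fscale h"
    by (rule lift2_tens2[OF assms(1)])
  show ?thesis
    using lift2_in_subspace[OF assms(1) T2_subspace assms(2)]
    by (auto simp: End2_def linear_within_def l.add l.scale)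
qed

section \<open>Leg operators and their transposes\<close>

text \<open>Transposes of the leg operators of \<open>a \<otimes> b \<mapsto> h a b\<close>.\<close>

definition tr12 :: "('v \<Rightarrow> 'v \<Rightarrow> ('k, 'v) tensor2) \<Rightarrow> ('v \<Rightarrow> 'v \<Rightarrow> 'v \<Rightarrow> 'k) \<Rightarrow> 'v \<Rightarrow> 'v \<Rightarrow> 'v \<Rightarrow> 'k"
  where "tr12 h \<gamma> = (\<lambda>a b c. h a b (\<lambda>u v. \<gamma> u v c))"

definition tr13 :: "('v \<Rightarrow> 'v \<Rightarrow> ('k, 'v) tensor2) \<Rightarrow> ('v \<Rightarrow> 'v \<Rightarrow> 'v \<Rightarrow> 'k) \<Rightarrow> 'v \<Rightarrow> 'v \<Rightarrow> 'v \<Rightarrow> 'k"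
  where "tr13 h \<gamma> = (\<lambda>a b c. h a c (\<lambda>u v. \<gamma> u b v))"

definition tr23 :: "('v \<Rightarrow> 'v \<Rightarrow> ('k, 'v) tensor2) \<Rightarrow> ('v \<Rightarrow> 'v \<Rightarrow> 'v \<Rightarrow> 'k) \<Rightarrow> 'v \<Rightarrow> 'v \<Rightarrow> 'v \<Rightarrow> 'k"
  where "tr23 h \<gamma> = (\<lambda>a b c. h b c (\<lambda>u v. \<gamma> a u v))"

text \<open>Since every \<open>F c\<close> is bilinear, one Sweedler sum of \<open>t\<close> works
  for all \<open>c\<close>, and a fixed finite sum of linear functions is linear. This handles the
  tensor factor on which an operator does not act.\<close>

lemma linear_form_T2:
  assumes "vector_space s" "t \<in> T2 s"
    and F: "\<And>c. bilinear_map s (*) (F c)" "\<And>a b. Vector_Spaces.linear s (*) (\<lambda>c. F c a b)"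
  shows "Vector_Spaces.linear s (*) (\<lambda>c. t (F c))"
proof -
  obtain xs where xs: "\<And>\<beta>. bilinear_map s (*) \<beta> \<Longrightarrow> t \<beta> = (\<Sum>(a, b)\<leftarrow>xs. \<beta> a b)"
    using T2_Sweedler[OF assms(1,2)] by blast
  show ?thesis
    using F(2) unfolding xs[OF F(1)] linear_form_iff[OF assms(1)]
    by (simp add: case_prod_unfold sum_list_addf sum_list_const_mult)
qed

text \<open>These are instances of \<open>form_lift2\<close> in which the functional is evaluation
  at \<open>\<gamma>\<close>.\<close>

lemma place_apply:
  assumes vs: "vector_space s" and t: "t \<in> T2 s"
  shows "place12 s c t \<gamma> = t (\<lambda>a b. tens3 s a b c \<gamma>)"
    "place13 s c t \<gamma> = t (\<lambda>a b. tens3 s a c b \<gamma>)"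
    "place23 s c t \<gamma> = t (\<lambda>a b. tens3 s c a b \<gamma>)"
  unfolding place12_def place13_def place23_def
  by (rule form_lift2[OF trilinear_slices(1)[OF trilinear_tens3[OF vs]] linear_evaluation t]
      form_lift2[OF trilinear_slices(2)[OF trilinear_tens3[OF vs]] linear_evaluation t]
      form_lift2[OF trilinear_slices(3)[OF trilinear_tens3[OF vs]] linear_evaluation t])+

lemma place_in_T3:
  assumes vs: "vector_space s" and t: "t \<in> T2 s"
  shows "place12 s c t \<in> T3 s" "place13 s c t \<in> T3 s" "place23 s c t \<in> T3 s"
  unfolding place12_def place13_def place23_def
  using trilinear_slices[OF trilinear_tens3[OF vs]]
  by (auto intro!: lift2_in_subspace T3_subspace tens3_in_T3 t)

context
  fixes s :: "'k::field \<Rightarrow> 'v::ab_group_add \<Rightarrow> 'v" and h :: "'v \<Rightarrow> 'v \<Rightarrow> ('k, 'v) tensor2"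
  assumes vs: "vector_space s" and h: "bilinear_map s fscale h" and h_in: "\<And>a b. h a b \<in> T2 s"
begin

lemma linear_h:
  "Vector_Spaces.linear s (*) (\<lambda>a. h a b \<beta>)" "Vector_Spaces.linear s (*) (\<lambda>a. h b a \<beta>)"
  using bilinear_fscaleD[OF h] by (auto simp: bilinear_map_def)

text \<open>In the two arguments fed to \<open>h\<close>, linearity comes from \<open>h\<close>; in
  the remaining argument it comes from \<open>linear_form_T2\<close>.\<close>

lemma trilinear_tr:
  assumes \<gamma>: "trilinear_map s (*) \<gamma>"
  shows "trilinear_map s (*) (tr12 h \<gamma>)" "trilinear_map s (*) (tr13 h \<gamma>)"
    "trilinear_map s (*) (tr23 h \<gamma>)"
  unfolding trilinear_map_def tr12_def tr13_def tr23_def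
  using \<gamma>[unfolded trilinear_map_def]
  by (auto intro!: linear_h linear_form_T2[OF vs h_in] trilinear_slices[OF \<gamma>])

text \<open>Evaluated at \<open>\<gamma>\<close>, these maps are the transposes applied to the form
  sending \<open>a\<close>, \<open>b\<close>, \<open>c\<close> to
  \<open>tens3 s a b c \<gamma>\<close>. That form is trilinear for every \<open>\<gamma>\<close>,
  so \<open>trilinear_tr\<close> applies.\<close>

lemma trilinear_place:
  "trilinear_map s fscale (\<lambda>a b c. place12 s c (h a b))"
  "trilinear_map s fscale (\<lambda>a b c. place13 s b (h a c))"
  "trilinear_map s fscale (\<lambda>a b c. place23 s a (h b c))"
  using trilinear_tr[OF trilinear_fscaleD[OF trilinear_tens3[OF vs]]]
  by (auto intro!: trilinear_fscaleI[OF vs] simp: place_apply[OF vs h_in] tr12_def tr13_def tr23_def)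

lemma leg_in_T3:
  assumes "t \<in> T3 s"
  shows "leg12 s (lift2 s fscale h) t \<in> T3 s" "leg13 s (lift2 s fscale h) t \<in> T3 s"
    "leg23 s (lift2 s fscale h) t \<in> T3 s"
  unfolding leg12_def leg13_def leg23_def lift2_tens2(2)[OF h]
  by (auto intro!: lift3_in_subspace trilinear_place T3_subspace place_in_T3 vs h_in assms)

text \<open>Evaluation at \<open>\<gamma>\<close> dissolves both layers of induced maps, the outer
  \<open>lift3\<close> and the \<open>lift2\<close> inside the placement. Trilinearity of
  \<open>\<gamma>\<close> rules out the default value of \<open>tens3\<close>.\<close>

lemma leg_apply:
  assumes t: "t \<in> T3 s" and \<gamma>: "trilinear_map s (*) \<gamma>"
  shows "leg12 s (lift2 s fscale h) t \<gamma> = t (tr12 h \<gamma>)"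
    "leg13 s (lift2 s fscale h) t \<gamma> = t (tr13 h \<gamma>)"
    "leg23 s (lift2 s fscale h) t \<gamma> = t (tr23 h \<gamma>)"
  unfolding leg12_def leg13_def leg23_def lift2_tens2(2)[OF h]
    form_lift3[OF trilinear_place(1) linear_evaluation t]
    form_lift3[OF trilinear_place(2) linear_evaluation t]
    form_lift3[OF trilinear_place(3) linear_evaluation t]
    place_apply[OF vs h_in] tr12_def tr13_def tr23_def
  using \<gamma> by (simp_all add: tens3_def)

end

lemma vector_space_fin_dim: "fin_dim s \<Longrightarrow> vector_space s"
  by (auto simp: fin_dim_def finite_dimensional_vector_space_def)

text \<open>Transposition reverses composition, which is why the transposes in \<open>YB\<close>
  stand in the opposite order to the legs. The legs preserve \<open>T3 s\<close> and the transposes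
  preserve trilinearity, so they can be moved across one at a time.\<close>

lemma yang_baxter_operatorI:
  assumes "fin_dim s" "Z \<subseteq> X \<times> X" "\<And>p. p \<in> Z \<Longrightarrow> \<phi> p \<in> X"
    and h: "\<And>x. bilinear_map s fscale (h x)" "\<And>x a b. h x a b \<in> T2 s"
    and YB: "\<And>x z \<gamma>. (x, z) \<in> Z \<Longrightarrow> trilinear_map s (*) \<gamma> \<Longrightarrow>
      tr23 (h z) (tr13 (h (\<phi> (x, z))) (tr12 (h x) \<gamma>)) =
      tr12 (h x) (tr13 (h (\<phi> (x, z))) (tr23 (h z) \<gamma>))"
  shows "yang_baxter_operator s X Z \<phi> (\<lambda>x. lift2 s fscale (h x))"
proof -
  note vs = vector_space_fin_dim[OF \<open>fin_dim s\<close>]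
  have "leg12 s (lift2 s fscale (h x)) (leg13 s (lift2 s fscale (h (\<phi> (x, z))))
        (leg23 s (lift2 s fscale (h z)) t)) =
      leg23 s (lift2 s fscale (h z)) (leg13 s (lift2 s fscale (h (\<phi> (x, z))))
        (leg12 s (lift2 s fscale (h x)) t))" if "(x, z) \<in> Z" "t \<in> T3 s" for x z t
    by (rule T3_eqI[of _ s])
      (simp_all add: leg_in_T3[OF vs h] leg_apply[OF vs h] trilinear_tr[OF vs h] YB that)
  with assms(1-3) show ?thesis
    unfolding yang_baxter_operator_def by (auto intro!: lift2_in_End2 h)
qed

section \<open>Operators from an algebra, and their inverses\<close>

context fd_algebra
begin

definition YB_tens :: "'k \<Rightarrow> 'k \<Rightarrow> 'a \<Rightarrow> 'a \<Rightarrow> ('k, 'a) tensor2"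
  where "YB_tens q x a b = fscale (x - 1) (tens2 s 1 (a * b)) + fscale (q * (x - 1)) (tens2 s (a * b) 1)
    - fscale (x - q) (tens2 s b a)"

lemma algebra_YB_lift2: "algebra_YB s q x = lift2 s fscale (YB_tens q x)"
  unfolding algebra_YB_def YB_tens_def ..

text \<open>The coefficients stay free so that the first family covers the operator itself and the
  second, with the reversed product, the formula for its inverse.\<close>

lemma bilinear_mult_tens2:
  "bilinear_map s fscale (\<lambda>a b. fscale c (tens2 s 1 (a * b)) + fscale d (tens2 s (a * b) 1)
    - fscale e (tens2 s b a))"
  "bilinear_map s fscale (\<lambda>a b. fscale c (tens2 s (b * a) 1) + fscale d (tens2 s 1 (b * a))
    - fscale e (tens2 s b a))"
proof -
  note vs = vector_space_fin_dim[OF fin_dim]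
  note B = bilinear_fscaleD[OF bilinear_tens2[OF vs], unfolded bilinear_form_iff[OF vs]]
  show "bilinear_map s fscale (\<lambda>a b. fscale c (tens2 s 1 (a * b)) + fscale d (tens2 s (a * b) 1)
    - fscale e (tens2 s b a))"
  "bilinear_map s fscale (\<lambda>a b. fscale c (tens2 s (b * a) 1) + fscale d (tens2 s 1 (b * a))
    - fscale e (tens2 s b a))"
    by (rule bilinear_fscaleI[OF vs]; simp add: bilinear_form_iff[OF vs] fscale_def B
        scale_mult_left scale_mult_right; simp add: algebra_simps B)+
qed

lemma YB_tens_apply:
  assumes "bilinear_map s (*) \<beta>"
  shows "YB_tens q x a b \<beta> = (x - 1) * \<beta> 1 (a * b) + q * (x - 1) * \<beta> (a * b) 1 - (x - q) * \<beta> b a"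
  using assms by (simp add: YB_tens_def tens2_def fscale_def)

lemma bilinear_YB_tens: "bilinear_map s fscale (YB_tens q x)"
  unfolding YB_tens_def by (rule bilinear_mult_tens2)

lemma YB_tens_in: "YB_tens q x a b \<in> T2 s"
  unfolding YB_tens_def by (intro T2_closed)

lemma yang_baxter_algebra:
  assumes "Z \<subseteq> X \<times> X" "\<forall>(x, z)\<in>Z. x * z \<in> X"
  shows "yang_baxter_operator s X Z (\<lambda>(x, z). x * z) (algebra_YB s q)"
proof -
  note vs = vector_space_fin_dim[OF fin_dim]
  note h = bilinear_YB_tens YB_tens_in
  show ?thesis unfolding algebra_YB_lift2
  proof (rule yang_baxter_operatorI[OF fin_dim assms(1) _ h])
    show "(case p of (x, z) \<Rightarrow> x * z) \<in> X" if "p \<in> Z" for p using assms(2) that by auto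
    fix x z \<gamma> assume \<gamma>: "trilinear_map s (*) \<gamma>"
    note tri = trilinear_tr[OF vs h]
    have tr12: "tr12 (YB_tens q x) \<gamma> a b c =
          (x - 1) * \<gamma> 1 (a * b) c + q * (x - 1) * \<gamma> (a * b) 1 c - (x - q) * \<gamma> b a c"
      and tr13: "tr13 (YB_tens q x) \<gamma> a b c =
          (x - 1) * \<gamma> 1 b (a * c) + q * (x - 1) * \<gamma> (a * c) b 1 - (x - q) * \<gamma> c b a"
      and tr23: "tr23 (YB_tens q x) \<gamma> a b c =
          (x - 1) * \<gamma> a 1 (b * c) + q * (x - 1) * \<gamma> a (b * c) 1 - (x - q) * \<gamma> a c b"
      if "trilinear_map s (*) \<gamma>" for x \<gamma> a b c
      using trilinear_slices[OF that] by (simp_all add: tr12_def tr13_def tr23_def YB_tens_apply)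
    show "tr23 (YB_tens q z) (tr13 (YB_tens q (case (x, z) of (x, z) \<Rightarrow> x * z)) (tr12 (YB_tens q x) \<gamma>)) =
      tr12 (YB_tens q x) (tr13 (YB_tens q (case (x, z) of (x, z) \<Rightarrow> x * z)) (tr23 (YB_tens q z) \<gamma>))"
      \<comment> \<open>Associativity and the unit laws bring the arguments of
        \<open>\<gamma>\<close> to a common form; the coefficients then agree as polynomials in
        \<open>x\<close>, \<open>z\<close> and \<open>q\<close>.\<close>
      by (intro ext) (simp add: tri \<gamma> tr12 tr13 tr23 algebra_simps)
  qed
qed

text \<open>The candidate inverse is again an induced map, so both composites need checking on pure
  tensors only. The hypotheses make the denominators nonzero.\<close>

lemma inverse_algebra_YB:
  assumes "x \<noteq> q" "q * x \<noteq> 1"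
  shows "bij_betw (algebra_YB s q x) (T2 s) (T2 s)"
    and "inv_into (T2 s) (algebra_YB s q x) (tens2 s a b) =
          fscale ((x - 1) / ((q * x - 1) * (x - q))) (tens2 s (b * a) 1)
          + fscale (q * (x - 1) / ((q * x - 1) * (x - q))) (tens2 s 1 (b * a))
          - fscale (1 / (x - q)) (tens2 s b a)"
proof -
  let ?D = "(q * x - 1) * (x - q)"
  define g where "g = (\<lambda>a b. fscale ((x - 1) / ?D) (tens2 s (b * a) 1)
          + fscale (q * (x - 1) / ?D) (tens2 s 1 (b * a)) - fscale (1 / (x - q)) (tens2 s b a))"
  let ?R = "algebra_YB s q x" and ?S = "lift2 s fscale g"
  note h = bilinear_YB_tens YB_tens_in
  have g: "bilinear_map s fscale g" "g a b \<in> T2 s" for a b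
    unfolding g_def by (intro bilinear_mult_tens2 T2_closed)+
  have R: "?R t \<in> T2 s" "?S t \<in> T2 s" if "t \<in> T2 s" for t
    using lift2_in_End2[OF h] lift2_in_End2[OF g] that by (auto simp: algebra_YB_lift2 End2_def)
  interpret R: Vector_Spaces.linear fscale fscale ?R
    unfolding algebra_YB_lift2 by (rule lift2_tens2[OF h(1)])
  interpret S: Vector_Spaces.linear fscale fscale ?S by (rule lift2_tens2[OF g(1)])
  have Rt: "?R (tens2 s a b) = YB_tens q x a b" for a b
    by (simp add: algebra_YB_lift2 lift2_tens2[OF h(1)])
  have St: "?S (tens2 s a b) = g a b" for a b by (simp add: lift2_tens2[OF g(1)])
  have ne: "q * x - 1 \<noteq> 0" "x - q \<noteq> 0" using assms by auto
  \<comment> \<open>With \<open>p = b * a\<close>, only the tensors of \<open>1\<close> with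
    \<open>p\<close>, of \<open>p\<close> with \<open>1\<close> and of \<open>a\<close> with
    \<open>b\<close> occur; the first two cancel.\<close>
  have RS: "?R (?S (tens2 s a b)) = tens2 s a b" for a b
    unfolding St unfolding g_def R.add R.diff R.scale Rt YB_tens_def
    using ne by (auto simp: fun_eq_iff fscale_def divide_simps) (simp_all add: algebra_simps)
  \<comment> \<open>In this order the same cancellation happens with
    \<open>p = a * b\<close>.\<close>
  have SR: "?S (?R (tens2 s a b)) = tens2 s a b" for a b
    unfolding Rt YB_tens_def S.add S.diff S.scale St unfolding g_def
    using ne by (auto simp: fun_eq_iff fscale_def divide_simps) (simp_all add: algebra_simps)
  \<comment> \<open>Knowledge on pure tensors extends only to their span, since induced maps are
    arbitrary extensions outside it.\<close>
  have idI: "F t = t" if "Vector_Spaces.linear fscale fscale F" "\<And>a b. F (tens2 s a b) = tens2 s a b"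
    "t \<in> T2 s" for F t
  proof -
    interpret F: Vector_Spaces.linear fscale fscale F by fact
    from that(3) show ?thesis unfolding T2_def
    proof (induction rule: fscale.span_induct_alt)
      case base
      show ?case by (rule F.zero)
    next
      case (step c x y)
      with that(2) show ?case by (auto simp only: F.add F.scale)
    qed
  qed
  have RS': "?R (?S t) = t" if "t \<in> T2 s" for t
    using idI[OF Vector_Spaces.linear_compose[OF S.linear_axioms R.linear_axioms] _ that]
    by (simp add: RS)
  have SR': "?S (?R t) = t" if "t \<in> T2 s" for t
    using idI[OF Vector_Spaces.linear_compose[OF R.linear_axioms S.linear_axioms] _ that]
    by (simp add: SR)
  show bij: "bij_betw ?R (T2 s) (T2 s)"
    by (rule bij_betw_byWitness[of _ ?S]) (use R RS' SR' in auto)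
  \<comment> \<open>Injectivity on \<open>T2 s\<close> identifies the value of
    \<open>inv_into\<close> with any preimage in \<open>T2 s\<close>, here
    \<open>g a b\<close>.\<close>
  have "inv_into (T2 s) ?R (tens2 s a b) = g a b"
    using bij St[of a b] R(2) RS'
    by (intro inv_into_f_eq) (auto simp: bij_betw_def tens2_in_T2 g(2) RS simp flip: St)
  then show "inv_into (T2 s) (algebra_YB s q x) (tens2 s a b) =
          fscale ((x - 1) / ?D) (tens2 s (b * a) 1)
          + fscale (q * (x - 1) / ?D) (tens2 s 1 (b * a))
          - fscale (1 / (x - q)) (tens2 s b a)" by (simp add: g_def)
qed

end

section \<open>Operators from a coalgebra, by Sweedler sums\<close>

context fd_coalgebra
begin

lemma vs: "vector_space s" by (rule vector_space_fin_dim[OF fin_dim])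

abbreviation lin where "lin \<equiv> Vector_Spaces.linear s (*)"
abbreviation bil where "bil \<equiv> bilinear_map s (*)"

definition YB_tens :: "'k \<Rightarrow> 'k \<Rightarrow> 'c \<Rightarrow> 'c \<Rightarrow> ('k, 'c) tensor2"
  where "YB_tens q x c d = fscale ((x - 1) * \<epsilon> c) (\<Delta> d) + fscale (q * (x - 1) * \<epsilon> d) (\<Delta> c)
    - fscale (x - q) (tens2 s d c)"

text \<open>Unlike \<open>\<Delta> c\<close>, the Sweedler sum \<open>D c\<close> is linear on all functions of two arguments, so it can be
  expanded without bilinearity side conditions.\<close>

definition sweedler :: "'c \<Rightarrow> ('c \<times> 'c) list"
  where "sweedler = (SOME xs. \<forall>c \<beta>. bil \<beta> \<longrightarrow> \<Delta> c \<beta> = (\<Sum>(a, b)\<leftarrow>xs c. \<beta> a b))"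

definition D :: "'c \<Rightarrow> ('c \<Rightarrow> 'c \<Rightarrow> 'k) \<Rightarrow> 'k"
  where "D c \<beta> = (\<Sum>(a, b)\<leftarrow>sweedler c. \<beta> a b)"

text \<open>The chosen list for \<open>c\<close> serves all bilinear forms at once, so on them the
  choice is invisible.\<close>

lemma Delta_eq_D: "bil \<beta> \<Longrightarrow> \<Delta> c \<beta> = D c \<beta>"
proof -
  have "\<exists>xs. \<forall>c \<beta>. bil \<beta> \<longrightarrow> \<Delta> c \<beta> = (\<Sum>(a, b)\<leftarrow>xs c. \<beta> a b)"
    using T2_Sweedler[OF vs comult_in] by (intro choice) blast
  from someI_ex[OF this] show "bil \<beta> \<Longrightarrow> \<Delta> c \<beta> = D c \<beta>"
    by (simp add: sweedler_def D_def)
qed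

lemma D_linear:
  "D c (\<lambda>u v. f u v + g u v) = D c f + D c g"
  "D c (\<lambda>u v. f u v - g u v) = D c f - D c g"
  "D c (\<lambda>u v. k * f u v) = k * D c f"
  unfolding D_def
  by (simp_all add: case_prod_unfold sum_list_addf sum_list_subtractf sum_list_const_mult)

text \<open>There are two sources of linearity: a fixed list applied to a linear family, and
  linearity of \<open>\<Delta>\<close>. The second passes through \<open>Delta_eq_D\<close> and
  therefore asks for a bilinear \<open>\<beta>\<close>.\<close>

lemma lin_D:
  "(\<And>u v. lin (\<lambda>a. f a u v)) \<Longrightarrow> lin (\<lambda>a. D c (f a))"
  "bil \<beta> \<Longrightarrow> lin (\<lambda>a. D a \<beta>)"
proof -
  show "lin (\<lambda>a. D c (f a))" if "\<And>u v. lin (\<lambda>a. f a u v)"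
    using that unfolding linear_form_iff[OF vs] D_def
    by (simp add: case_prod_unfold sum_list_addf sum_list_const_mult)
  show "lin (\<lambda>a. D a \<beta>)" if "bil \<beta>"
    using linear_fscaleD[OF comult_linear, of \<beta>] that by (simp add: Delta_eq_D)
qed

lemma bilI: "(\<And>b. lin (\<lambda>a. f a b)) \<Longrightarrow> (\<And>a. lin (f a)) \<Longrightarrow> bil f"
  by (simp add: bilinear_map_def)

lemma lin_mult: "lin f \<Longrightarrow> lin (\<lambda>a. k * f a)" "lin f \<Longrightarrow> lin (\<lambda>a. f a * k)"
  by (simp_all add: linear_form_iff[OF vs] algebra_simps)

text \<open>The linear form \<open>f\<close> is applied to the counit laws through
  \<open>form_lift2\<close>. The four variants let the rule fire without reordering factors.\<close>

lemma D_counit: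
  assumes "lin f"
  shows "D c (\<lambda>u v. \<epsilon> u * f v) = f c" "D c (\<lambda>u v. \<epsilon> v * f u) = f c"
    "D c (\<lambda>u v. f v * \<epsilon> u) = f c" "D c (\<lambda>u v. f u * \<epsilon> v) = f c"
proof -
  note e = counit_linear[unfolded linear_form_iff[OF vs]]
  have f_scale: "f (s k a) = k * f a" for k a
    using assms by (simp add: linear_form_iff[OF vs])
  interpret v: vector_space s by (rule vs)
  have bil: "bilinear_map s s (\<lambda>a b. s (\<epsilon> a) b)" "bilinear_map s s (\<lambda>a b. s (\<epsilon> b) a)"
    unfolding bilinear_map_def
    by (auto intro!: Vector_Spaces.linear.intro module_hom.intro module_hom_axioms.intro vs v.module_axioms
        simp: e v.scale_left_distrib v.scale_right_distrib mult.commute)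
  have b: "bil (\<lambda>u v. \<epsilon> u * f v)" "bil (\<lambda>u v. \<epsilon> v * f u)"
    by (intro bilI lin_mult counit_linear assms)+
  have "f c = \<Delta> c (\<lambda>u v. \<epsilon> u * f v)" "f c = \<Delta> c (\<lambda>u v. \<epsilon> v * f u)"
    using form_lift2[OF bil(1) assms comult_in] form_lift2[OF bil(2) assms comult_in]
    unfolding counit_left counit_right f_scale by blast+
  then show "D c (\<lambda>u v. \<epsilon> u * f v) = f c" "D c (\<lambda>u v. \<epsilon> v * f u) = f c"
    unfolding Delta_eq_D[OF b(1)] Delta_eq_D[OF b(2)] by simp_all
  then show "D c (\<lambda>u v. f v * \<epsilon> u) = f c" "D c (\<lambda>u v. f u * \<epsilon> v) = f c"
    by (simp_all add: mult.commute)
qed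

text \<open>This is coassociativity evaluated at \<open>\<gamma>\<close>. Used from left to right,
  it moves the inner comultiplication to the right factor, so that iterated sums take one
  shape.\<close>

lemma D_coassoc:
  assumes \<gamma>: "trilinear_map s (*) \<gamma>"
  shows "D c (\<lambda>u v. D u (\<lambda>p r. \<gamma> p r v)) = D c (\<lambda>u v. D v (\<lambda>p r. \<gamma> u p r))"
proof -
  note sl = trilinear_slices[OF \<gamma>]
  have t: "tens3 s a b c \<gamma> = \<gamma> a b c" for a b c using \<gamma> by (simp add: tens3_def)
  \<comment> \<open>Bilinearity is what \<open>form_lift2\<close> asks for. At any function the maps
    become Sweedler sums of \<open>tens3\<close> values, which are trilinear even there because of
    the default 0.\<close>
  have D2: "bilinear_map s fscale (\<lambda>a b. place12 s b (\<Delta> a))"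
    "bilinear_map s fscale (\<lambda>a b. place23 s a (\<Delta> b))"
  proof -
    note T = trilinear_fscaleD[OF trilinear_tens3[OF vs], unfolded trilinear_map_def]
    note T' = trilinear_slices[OF trilinear_fscaleD[OF trilinear_tens3[OF vs]]]
    show "bilinear_map s fscale (\<lambda>a b. place12 s b (\<Delta> a))"
      "bilinear_map s fscale (\<lambda>a b. place23 s a (\<Delta> b))"
      by (rule bilinear_fscaleI[OF vs];
        use T in \<open>auto intro!: bilI lin_D T' simp: place_apply[OF vs comult_in] Delta_eq_D T'\<close>)+
  qed
  have "lift2 s fscale (\<lambda>a b. place12 s b (\<Delta> a)) (\<Delta> c) \<gamma> = D c (\<lambda>u v. D u (\<lambda>p r. \<gamma> p r v))"
    "lift2 s fscale (\<lambda>a b. place23 s a (\<Delta> b)) (\<Delta> c) \<gamma> = D c (\<lambda>u v. D v (\<lambda>p r. \<gamma> u p r))"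
    using sl \<gamma>[unfolded trilinear_map_def]
    by (subst form_lift2[OF D2(1) linear_evaluation comult_in]
        form_lift2[OF D2(2) linear_evaluation comult_in],
      auto simp: place_apply[OF vs comult_in] t Delta_eq_D intro!: bilI lin_D Delta_eq_D)+
  then show ?thesis by (simp add: coassoc)
qed

lemma coalgebra_YB_lift2: "coalgebra_YB s \<Delta> \<epsilon> q = (\<lambda>x. lift2 s fscale (YB_tens q x))"
  unfolding coalgebra_YB_def YB_tens_def ..

lemma YB_tens_apply:
  assumes "bil \<beta>"
  shows "YB_tens q x c d \<beta> = (x - 1) * \<epsilon> c * D d \<beta> + q * (x - 1) * \<epsilon> d * D c \<beta> - (x - q) * \<beta> d c"
  using assms by (simp add: YB_tens_def tens2_def fscale_def Delta_eq_D)

lemma bilinear_YB_tens: "bilinear_map s fscale (YB_tens q x)"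
proof (rule bilinear_fscaleI[OF vs])
  fix \<beta>
  note e = counit_linear[unfolded linear_form_iff[OF vs]]
  \<comment> \<open>Here \<open>\<beta>\<close> is arbitrary, so linearity is taken from
    \<open>\<Delta>\<close> itself; for \<open>D\<close> it is established at bilinear forms
    only.\<close>
  note d = linear_fscaleD[OF comult_linear, unfolded linear_form_iff[OF vs]]
  note B = bilinear_fscaleD[OF bilinear_tens2[OF vs], unfolded bilinear_form_iff[OF vs]]
  show "bil (\<lambda>a b. YB_tens q x a b \<beta>)"
    unfolding bilinear_form_iff[OF vs]
    by (simp add: YB_tens_def fscale_def e d B) (simp add: algebra_simps)
qed

lemma YB_tens_in: "YB_tens q x a b \<in> T2 s"
  unfolding YB_tens_def by (intro T2_closed comult_in)

lemma yang_baxter_coalgebra: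
  assumes "Z \<subseteq> X \<times> X" "\<forall>(x, z)\<in>Z. x * z \<in> X"
  shows "yang_baxter_operator s X Z (\<lambda>(x, z). x * z) (coalgebra_YB s \<Delta> \<epsilon> q)"
proof -
  note h = bilinear_YB_tens YB_tens_in
  show ?thesis unfolding coalgebra_YB_lift2
  proof (rule yang_baxter_operatorI[OF fin_dim assms(1) _ h])
    show "(case p of (x, z) \<Rightarrow> x * z) \<in> X" if "p \<in> Z" for p using assms(2) that by auto
    fix x z :: 'k and \<gamma> assume \<gamma>: "trilinear_map s (*) \<gamma>"
    note tri = trilinear_tr[OF vs h]
    have l\<gamma>: "lin (\<lambda>a. \<gamma> a b c)" "lin (\<lambda>a. \<gamma> b a c)" "lin (\<lambda>a. \<gamma> b c a)" "lin (\<gamma> b c)" for b c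
      using \<gamma> by (auto simp: trilinear_map_def)
    have triI: "trilinear_map s (*) f" if "\<And>b c. lin (\<lambda>a. f a b c)" "\<And>a c. lin (\<lambda>b. f a b c)"
      "\<And>a b. lin (f a b)" for f
      using that by (simp add: trilinear_map_def)
    text \<open>Opaque coefficients keep the normalisation below from multiplying them out.\<close>
    define A where "A = (\<lambda>x::'k. x - 1)"
    define B where "B = (\<lambda>x::'k. q * (x - 1))"
    define G where "G = (\<lambda>x::'k. x - q)"
    define y where "y = x * z"
    \<comment> \<open>Commutativity is kept out of the normalisation below, so scalars standing on
      the right need their own rule.\<close>
    have D_right: "D c (\<lambda>u v. f u v * k) = D c f * k" for c f k
      using D_linear(3)[of c k f] by (simp only: mult.commute)
    have tr12: "tr12 (YB_tens q x) \<gamma> a b c = A x * (\<epsilon> a * D b (\<lambda>u v. \<gamma> u v c)) +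
          B x * (\<epsilon> b * D a (\<lambda>u v. \<gamma> u v c)) - G x * \<gamma> b a c"
      and tr13: "tr13 (YB_tens q x) \<gamma> a b c = A x * (\<epsilon> a * D c (\<lambda>u v. \<gamma> u b v)) +
          B x * (\<epsilon> c * D a (\<lambda>u v. \<gamma> u b v)) - G x * \<gamma> c b a"
      and tr23: "tr23 (YB_tens q x) \<gamma> a b c = A x * (\<epsilon> b * D c (\<lambda>u v. \<gamma> a u v)) +
          B x * (\<epsilon> c * D b (\<lambda>u v. \<gamma> a u v)) - G x * \<gamma> a c b"
      if "trilinear_map s (*) \<gamma>" for x \<gamma> a b c
      using trilinear_slices[OF that]
      by (simp_all add: A_def B_def G_def tr12_def tr13_def tr23_def YB_tens_apply)
    \<comment> \<open>Besides rewrite rules, the list holds the linearity, bilinearity and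
      trilinearity facts that discharge their side conditions.\<close>
    note rules = D_linear D_right D_counit l\<gamma> lin_D lin_mult counit_linear bilI D_coassoc triI
    have "tr23 (YB_tens q z) (tr13 (YB_tens q y) (tr12 (YB_tens q x) \<gamma>)) a b c =
      tr12 (YB_tens q x) (tr13 (YB_tens q y) (tr23 (YB_tens q z) \<gamma>)) a b c" for a b c
      \<comment> \<open>First the transposes are expanded; then sums and scalars leave
        \<open>D\<close>, counits cancel and nested sums are right-associated. Unfolding the
        coefficients afterwards leaves the polynomial identity.\<close>
      by (simp only: tri \<gamma> tr12 tr13 tr23, simp only: rules ring_distribs mult.assoc)
        (simp add: A_def B_def G_def y_def algebra_simps)
    then show "tr23 (YB_tens q z) (tr13 (YB_tens q (case (x, z) of (x, z) \<Rightarrow> x * z)) (tr12 (YB_tens q x) \<gamma>)) =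
      tr12 (YB_tens q x) (tr13 (YB_tens q (case (x, z) of (x, z) \<Rightarrow> x * z)) (tr23 (YB_tens q z) \<gamma>))"
      by (intro ext) (simp add: y_def)
  qed
qed

end

text \<open>The formulas on pure tensors accompany the Yang-Baxter claims because both operators
  come from a choice in \<open>lift2\<close>. Given \<open>bij_betw\<close>, \<open>inv_into\<close>
  is the genuine inverse on \<open>T2 sA\<close>.\<close>

theorem proposition4p1:
  fixes X :: "'k::field set" and Z :: "('k \<times> 'k) set"
    and sA :: "'k \<Rightarrow> 'a::{ring, monoid_mult} \<Rightarrow> 'a"
    and sC :: "'k \<Rightarrow> 'c::ab_group_add \<Rightarrow> 'c"
    and \<Delta> :: "'c \<Rightarrow> ('k, 'c) tensor2" and \<epsilon> :: "'c \<Rightarrow> 'k"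
  assumes "Z \<subseteq> X \<times> X" and "\<forall>(x, z)\<in>Z. x * z \<in> X"
  shows "(fd_algebra sA \<longrightarrow>
      (\<forall>q.
        (\<forall>x\<in>X. \<forall>a b. algebra_YB sA q x (tens2 sA a b) =
          fscale (x - 1) (tens2 sA 1 (a * b)) + fscale (q * (x - 1)) (tens2 sA (a * b) 1)
          - fscale (x - q) (tens2 sA b a)) \<and>
        yang_baxter_operator sA X Z (\<lambda>(x, z). x * z) (algebra_YB sA q)) \<and>
      (\<forall>q. \<forall>x\<in>X. x \<noteq> q \<and> q * x \<noteq> 1 \<longrightarrow>
        bij_betw (algebra_YB sA q x) (T2 sA) (T2 sA) \<and>
        (\<forall>a b. inv_into (T2 sA) (algebra_YB sA q x) (tens2 sA a b) =
          fscale ((x - 1) / ((q * x - 1) * (x - q))) (tens2 sA (b * a) 1)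
          + fscale (q * (x - 1) / ((q * x - 1) * (x - q))) (tens2 sA 1 (b * a))
          - fscale (1 / (x - q)) (tens2 sA b a))))
    \<and> (fd_coalgebra sC \<Delta> \<epsilon> \<longrightarrow>
      (\<forall>q.
        (\<forall>x\<in>X. \<forall>c d. coalgebra_YB sC \<Delta> \<epsilon> q x (tens2 sC c d) =
          fscale ((x - 1) * \<epsilon> c) (\<Delta> d) + fscale (q * (x - 1) * \<epsilon> d) (\<Delta> c)
          - fscale (x - q) (tens2 sC d c)) \<and>
        yang_baxter_operator sC X Z (\<lambda>(x, z). x * z) (coalgebra_YB sC \<Delta> \<epsilon> q)))"
proof (intro conjI impI allI ballI; (elim conjE)?)
  fix q x :: 'k and a b assume "fd_algebra sA"
  then interpret fd_algebra sA .
  show "algebra_YB sA q x (tens2 sA a b) =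
      fscale (x - 1) (tens2 sA 1 (a * b)) + fscale (q * (x - 1)) (tens2 sA (a * b) 1)
      - fscale (x - q) (tens2 sA b a)"
    by (simp only: algebra_YB_lift2 lift2_tens2(2)[OF bilinear_YB_tens] YB_tens_def)
next
  fix q :: 'k assume "fd_algebra sA"
  then show "yang_baxter_operator sA X Z (\<lambda>(x, z). x * z) (algebra_YB sA q)"
    using assms by (rule fd_algebra.yang_baxter_algebra)
next
  fix q x :: 'k assume "fd_algebra sA" "x \<noteq> q" "q * x \<noteq> 1"
  then show "bij_betw (algebra_YB sA q x) (T2 sA) (T2 sA)"
    by (rule fd_algebra.inverse_algebra_YB)
next
  fix q x :: 'k and a b assume "fd_algebra sA" "x \<noteq> q" "q * x \<noteq> 1"
  then show "inv_into (T2 sA) (algebra_YB sA q x) (tens2 sA a b) =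
      fscale ((x - 1) / ((q * x - 1) * (x - q))) (tens2 sA (b * a) 1)
      + fscale (q * (x - 1) / ((q * x - 1) * (x - q))) (tens2 sA 1 (b * a))
      - fscale (1 / (x - q)) (tens2 sA b a)"
    by (rule fd_algebra.inverse_algebra_YB)
next
  fix q x :: 'k and c d assume "fd_coalgebra sC \<Delta> \<epsilon>"
  then interpret fd_coalgebra sC \<Delta> \<epsilon> .
  show "coalgebra_YB sC \<Delta> \<epsilon> q x (tens2 sC c d) =
      fscale ((x - 1) * \<epsilon> c) (\<Delta> d) + fscale (q * (x - 1) * \<epsilon> d) (\<Delta> c)
      - fscale (x - q) (tens2 sC d c)"
    by (simp only: coalgebra_YB_lift2 lift2_tens2(2)[OF bilinear_YB_tens] YB_tens_def)
next
  fix q :: 'k assume "fd_coalgebra sC \<Delta> \<epsilon>"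
  then show "yang_baxter_operator sC X Z (\<lambda>(x, z). x * z) (coalgebra_YB sC \<Delta> \<epsilon> q)"
    using assms by (rule fd_coalgebra.yang_baxter_coalgebra)
qed

end
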